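(* Let $\{\boldsymbol Z_n\}_{n\ge 0}$ be a non-singular multitype Galton--Watson branching process with countable typeset $\mathcal X$ and progeny generating function $\boldsymbol G$. Let $\boldsymbol s\in[0,1]^{\mathcal X}$ satisfy $\boldsymbol s\le \boldsymbol G(\boldsymbol s)$. Then: (i) for all $x\in\mathcal X$, either $s_x=1$ or $s_x\le q_x(\{x\})$; (ii) if $s_x<1$, then $s_y\le q_y(\{y\})$ for all $y\in\mathcal X$ such that $y\to x$; (iii) if the process is irreducible and $\boldsymbol s\ne\boldsymbol 1$, then $\boldsymbol s\le\tilde{\boldsymbol q}$.
   Context: A multitype Galton--Watson branching process (MGWBP) $\{\boldsymbol Z_n\}_{n\ge0}$ with countable (finite or countably infinite) typeset $\mathcal X$: $\boldsymbol Z_n=(Z_{n,x})_{x\in\mathcal X}$, where $Z_{n,x}$ is the number of type-$x$ individuals in generation $n$. Each individual lives for one generation and at death, independently of all others, gives birth to a finite random number of offspring; a type-$x$ individual has $j_y$ children of type $y$ for all $y\in\mathcal X$ with probability $p_{x\boldsymbol j}$, $\boldsymbol j=(j_y)_{y\in\mathcal X}$, $|\boldsymbol j|:=\sum_y j_y<\infty$. The progeny generating function is $\boldsymbol G(\boldsymbol s)=(G_x(\boldsymbol s))_{x\in\mathcal X}$, $G_x(\boldsymbol s)=\sum_{\boldsymbol j:|\boldsymbol j|<\infty}p_{x\boldsymbol j}\prod_{y}s_y^{j_y}$, $\boldsymbol s\in[0,1]^{\mathcal X}$. $\mathbb P_x$ denotes the law of the process started from a single type-$x$ individual. For $A\subseteq\mathcal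 X$, $\mathcal E(A)$ is the event $\lim_{n\to\infty}\sum_{x\in A}Z_{n,x}=0$ (extinction in $A$); $q_x(A)=\mathbb P_x(\mathcal E(A))$; $\tilde q_x=\mathbb P_x\big(\bigcap_{A:|A|<\infty}\mathcal E(A)\big)$, $\tilde{\boldsymbol q}=(\tilde q_x)_{x\in\mathcal X}$. Vector inequalities $\le$ are componentwise; $\boldsymbol 1$ is the all-ones vector. Let $m_{xy}=\mathbb E_x[Z_{1,y}]$ and consider the directed graph on $\mathcal X$ with an edge $(x,y)$ iff $m_{xy}>0$. Write $x\to y$ if there is a path (possibly of length zero) from $x$ to $y$, and $x\leftrightarrow y$ if $x\to y$ and $y\to x$. The process is irreducible if $x\leftrightarrow y$ for all $x,y\in\mathcal X$. It is non-singular if for every $x\in\mathcal X$ there exists $y\leftrightarrow x$ such that $\mathbb P_y\big(\sum_{w\leftrightarrow y}Z_{1,w}=1\big)<1$. *)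

theory Defs
  imports "HOL-Probability.Probability"
begin

text \<open>
  A population is a finite multiset of types: the generation vector \<open>(Z\<^sub>x)\<^sub>x\<close> is \<open>count Z\<close>, and
  being a multiset encodes \<open>\<Sum>\<^sub>x Z\<^sub>x < \<infinity>\<close>. The offspring law of a type-\<open>x\<close> individual is
  \<open>p x\<close>, so \<open>pmf (p x) j\<close> is the probability of the offspring vector \<open>count j\<close>.
  The countable typeset is the universe of the type \<open>'x\<close>, which may be finite or infinite.
\<close>

type_synonym 'x offspring = "'x \<Rightarrow> 'x multiset pmf"

text \<open>Coordinate \<open>(n, y, i)\<close> is the litter of the \<open>i\<close>-th type-\<open>y\<close> individual of generation \<open>n\<close>.\<close>

definition litters :: "'x offspring \<Rightarrow> (nat \<times> 'x \<times> nat \<Rightarrow> 'x multiset) measure" where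
  "litters p = Pi\<^sub>M UNIV (\<lambda>(n, y, i). measure_pmf (p y))"

fun generation :: "'x \<Rightarrow> (nat \<times> 'x \<times> nat \<Rightarrow> 'x multiset) \<Rightarrow> nat \<Rightarrow> 'x multiset" where
  "generation x \<omega> 0 = {#x#}"
| "generation x \<omega> (Suc n) =
     (let Z = generation x \<omega> n in \<Sum>y\<in>set_mset Z. \<Sum>i<count Z y. \<omega> (n, y, i))"

text \<open>The law of the process on path space, started from a single type-\<open>x\<close> individual.\<close>

definition gw_law :: "'x offspring \<Rightarrow> 'x \<Rightarrow> (nat \<Rightarrow> 'x multiset) measure" where
  "gw_law p x = distr (litters p) (Pi\<^sub>M UNIV (\<lambda>_. count_space UNIV)) (generation x)"

definition progeny_gf :: "'x offspring \<Rightarrow> ('x \<Rightarrow> real) \<Rightarrow> 'x \<Rightarrow> real" where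
  "progeny_gf p s x = (\<Sum>\<^sub>\<infinity>j. pmf (p x) j * (\<Prod>y\<in>set_mset j. s y ^ count j y))"

text \<open>
  The population in \<open>A\<close> is counted by \<open>size\<close> of a filtered multiset because a \<open>sum\<close> over an
  infinite \<open>A\<close> would be \<open>0\<close> by convention.
\<close>

definition extinct_in :: "'x set \<Rightarrow> (nat \<Rightarrow> 'x multiset) set" where
  "extinct_in A = {Z. (\<lambda>n. real (size {#x \<in># Z n. x \<in> A#})) \<longlonglongrightarrow> 0}"

definition ext_prob :: "'x offspring \<Rightarrow> 'x set \<Rightarrow> 'x \<Rightarrow> real" where
  "ext_prob p A x = measure (gw_law p x) (extinct_in A)"

definition partial_ext_prob :: "'x offspring \<Rightarrow> 'x \<Rightarrow> real" where
  "partial_ext_prob p x = measure (gw_law p x) (\<Inter>A\<in>{A. finite A}. extinct_in A)"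

definition mean_offspring :: "'x offspring \<Rightarrow> 'x \<Rightarrow> 'x \<Rightarrow> ennreal" where
  "mean_offspring p x y = (\<integral>\<^sup>+ Z. of_nat (count (Z 1) y) \<partial>gw_law p x)"

definition leads_to :: "'x offspring \<Rightarrow> 'x \<Rightarrow> 'x \<Rightarrow> bool" where
  "leads_to p x y \<longleftrightarrow> (x, y) \<in> {(u, v). mean_offspring p u v > 0}\<^sup>*"

definition communicate :: "'x offspring \<Rightarrow> 'x \<Rightarrow> 'x \<Rightarrow> bool" where
  "communicate p x y \<longleftrightarrow> leads_to p x y \<and> leads_to p y x"

definition irreducible_process :: "'x offspring \<Rightarrow> bool" where
  "irreducible_process p \<longleftrightarrow> (\<forall>x y. communicate p x y)"

definition nonsingular :: "'x offspring \<Rightarrow> bool" where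
  "nonsingular p \<longleftrightarrow> (\<forall>x. \<exists>y. communicate p y x \<and>
     measure (gw_law p y) {Z. size {#w \<in># Z 1. communicate p w y#} = 1} < 1)"


text \<open>
  \<open>distr\<close> and \<open>measure\<close> are only meaningful on measurable arguments; the following facts
  show that the definitions above do not degenerate.
\<close>

lemma countable_multisets: "countable (UNIV :: 'x::countable multiset set)"
proof -
  have "countable (range (mset :: 'x list \<Rightarrow> _))" by (rule countable_image) simp
  moreover have "range (mset :: 'x list \<Rightarrow> _) = UNIV" by (metis surj_def ex_mset)
  ultimately show ?thesis by simp
qed

lemma measurable_plus_multiset:
  fixes f g :: "'a \<Rightarrow> 'x::countable multiset"
  assumes f: "f \<in> measurable M (count_space UNIV)" and g: "g \<in> measurable M (count_space UNIV)"
  shows "(\<lambda>\<omega>. f \<omega> + g \<omega>) \<in> measurable M (count_space UNIV)"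
proof (rule measurable_compose_countable'[OF _ f countable_multisets])
  fix z :: "'x multiset"
  show "(\<lambda>\<omega>. z + g \<omega>) \<in> measurable M (count_space UNIV)"
    by (rule measurable_compose[OF g]) simp
qed

lemma measurable_sum_multiset:
  fixes f :: "'i \<Rightarrow> 'a \<Rightarrow> 'x::countable multiset"
  assumes "\<And>i. i \<in> I \<Longrightarrow> f i \<in> measurable M (count_space UNIV)"
  shows "(\<lambda>\<omega>. \<Sum>i\<in>I. f i \<omega>) \<in> measurable M (count_space UNIV)"
  using assms by (induction I rule: infinite_finite_induct) (auto intro!: measurable_plus_multiset)

lemma prob_space_litters: "prob_space (litters p)"
  unfolding litters_def by (rule prob_space_PiM) (auto intro: measure_pmf.prob_space_axioms)

lemma measurable_litter [measurable]:
  "(\<lambda>\<omega>. \<omega> (n, y, i)) \<in> measurable (litters p) (count_space UNIV)"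
proof -
  have "(\<lambda>\<omega>. \<omega> (n, y, i)) \<in> measurable (litters p) (measure_pmf (p y))"
    using measurable_component_singleton[of "(n, y, i)" UNIV "\<lambda>(n, y, i). measure_pmf (p y)"]
    by (simp add: litters_def)
  then show ?thesis by simp
qed

lemma measurable_generation [measurable]:
  "(\<lambda>\<omega>. generation x \<omega> n) \<in> measurable (litters (p :: 'x::countable offspring)) (count_space UNIV)"
proof (induction n)
  case 0
  then show ?case by simp
next
  case (Suc n)
  show ?case
    unfolding generation.simps Let_def
    by (rule measurable_compose_countable'[OF _ Suc countable_multisets])
       (intro measurable_sum_multiset measurable_litter)
qed

lemma measurable_generation_path [measurable]:
  "generation x \<in> measurable (litters (p :: 'x::countable offspring)) (Pi\<^sub>M UNIV (\<lambda>_. count_space UNIV))"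
  by (rule measurable_PiM_single') (auto intro: measurable_generation)

lemma prob_space_gw_law: "prob_space (gw_law (p :: 'x::countable offspring) x)"
  unfolding gw_law_def
  by (intro prob_space.prob_space_distr prob_space_litters measurable_generation_path)

lemma space_gw_law [simp]: "space (gw_law p x) = UNIV"
  by (simp add: gw_law_def space_PiM)

lemma measurable_gw_law_coordinate [measurable]:
  "(\<lambda>Z. Z n) \<in> measurable (gw_law p x) (count_space UNIV)"
  by (simp add: gw_law_def)

lemma distr_first_generation:
  fixes p :: "'x::countable offspring"
  shows "distr (gw_law p x) (count_space UNIV) (\<lambda>Z. Z 1) = measure_pmf (p x)"
proof -
  have "distr (gw_law p x) (count_space UNIV) (\<lambda>Z. Z 1)
      = distr (litters p) (count_space UNIV) ((\<lambda>Z. Z 1) \<circ> generation x)"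
    unfolding gw_law_def by (rule distr_distr) simp_all
  also have "(\<lambda>Z. Z 1) \<circ> generation x = (\<lambda>\<omega>. \<omega> (0, x, 0))"
    by (simp add: fun_eq_iff)
  also have "distr (litters p) (count_space UNIV) \<dots> = distr (litters p) (measure_pmf (p x)) (\<lambda>\<omega>. \<omega> (0, x, 0))"
    by (rule distr_cong) simp_all
  also have "\<dots> = measure_pmf (p x)"
    using distr_PiM_component[of UNIV "\<lambda>(n, y, i). measure_pmf (p y)" "(0, x, 0)"]
    by (auto simp: litters_def intro: measure_pmf.prob_space_axioms)
  finally show ?thesis .
qed

lemma extinct_in_eq: "extinct_in A = {Z. \<forall>\<^sub>F n in sequentially. {#x \<in># Z n. x \<in> A#} = {#}}"
proof -
  have "(\<lambda>n. real (f n)) \<longlonglongrightarrow> 0 \<longleftrightarrow> (\<forall>\<^sub>F n in sequentially. f n = 0)" for f :: "nat \<Rightarrow> nat"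
  proof
    assume "(\<lambda>n. real (f n)) \<longlonglongrightarrow> 0"
    then have "\<forall>\<^sub>F n in sequentially. real (f n) < 1"
      by (rule order_tendstoD) simp
    then show "\<forall>\<^sub>F n in sequentially. f n = 0"
      by (rule eventually_mono) simp
  qed (auto intro: tendsto_eventually elim: eventually_mono)
  then show ?thesis by (simp add: extinct_in_def)
qed

lemma sets_extinct_in [measurable]: "extinct_in A \<in> sets (gw_law p x)"
proof -
  have "{Z \<in> space (gw_law p x). \<forall>\<^sub>F n in sequentially. {#x \<in># Z n. x \<in> A#} = {#}} \<in> sets (gw_law p x)"
    unfolding eventually_sequentially
  proof (intro sets.sets_Collect_countable_Ex sets.sets_Collect_countable_All)
    fix N n
    have "(\<lambda>Z. N \<le> n \<longrightarrow> {#x \<in># Z n. x \<in> A#} = {#}) \<in> measurable (gw_law p x) (count_space UNIV)"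
      by (rule measurable_compose[OF measurable_gw_law_coordinate[of n]]) simp
    then show "{Z \<in> space (gw_law p x). N \<le> n \<longrightarrow> {#x \<in># Z n. x \<in> A#} = {#}} \<in> sets (gw_law p x)"
      by (rule predE)
  qed
  then show ?thesis by (simp add: extinct_in_eq)
qed

lemma sets_partial_extinction:
  fixes p :: "'x::countable offspring"
  shows "(\<Inter>A\<in>{A. finite A}. extinct_in A) \<in> sets (gw_law p x)"
  by (rule sets.countable_INT') (auto intro: countable_Collect_finite)

lemma summable_progeny_gf:
  assumes "\<And>y. s y \<in> {0..1}"
  shows "(\<lambda>j. pmf (p x) j * (\<Prod>y\<in>set_mset j. s y ^ count j y)) summable_on UNIV"
proof (rule summable_on_comparison_test)
  show "pmf (p x) summable_on UNIV"
    using pmf_abs_summable[of "p x" UNIV] by (metis abs_summable_equivalent abs_summable_summable)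
next
  fix j
  have *: "0 \<le> s y" "s y \<le> 1" for y using assms[of y] by auto
  have "(\<Prod>y\<in>set_mset j. s y ^ count j y) \<le> 1"
    by (rule prod_le_1) (auto intro: power_le_one zero_le_power *)
  then show "pmf (p x) j * (\<Prod>y\<in>set_mset j. s y ^ count j y) \<le> pmf (p x) j"
    by (simp add: mult_left_le)
  show "0 \<le> pmf (p x) j * (\<Prod>y\<in>set_mset j. s y ^ count j y)"
    by (intro mult_nonneg_nonneg prod_nonneg ballI zero_le_power * pmf_nonneg)
qed

end

theory Submission
  imports Defs
begin

text \<open>
  Let \<open>M\<^sub>n\<close> be the product of \<open>s\<close> over the individuals of generation \<open>n\<close>. By the branching property and
  \<open>s \<le> G(s)\<close> it is a submartingale in \<open>[0, 1]\<close>, and so is its square, which belongs to \<open>s\<^sup>2 \<le> G(s\<^sup>2)\<close>.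
  If some iterate satisfies \<open>G\<^sup>k(s\<^sup>2)\<^sub>y > s\<^sub>y\<^sup>2\<close>, every visit to \<open>y\<close> raises the expectation of \<open>M\<^sub>n\<^sup>2\<close> by a fixed
  proportion, so the expectations of \<open>M\<^sub>n\<^sup>2\<close> over the event that \<open>y\<close> is alive at time \<open>n\<close> are summable.
  Stopping \<open>M\<^sub>n\<close> at the first late visit to a finite set \<open>A\<close> of such types then bounds \<open>s\<^sub>x\<close> by the
  probability of extinction in \<open>A\<close>.

  If no iterate is larger at \<open>y\<close> and \<open>0 < s\<^sub>y < 1\<close>, then \<open>M\<^sub>n\<close> is almost surely constant when started
  from \<open>y\<close>. Hence \<open>s\<close> is constant on the class of \<open>y\<close>, no individual has two children in the class, and
  by non-singularity some individual of the class may have none there. This is impossible in the irreducible case;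
  otherwise the argument applies to the function that agrees with \<open>s\<close> on the class
  and is \<open>1\<close> on the types from which the class cannot be reached.
\<close>

section \<open>Progeny generating functions\<close>

abbreviation mprod :: "('x \<Rightarrow> real) \<Rightarrow> 'x multiset \<Rightarrow> real" where
  "mprod s z \<equiv> \<Prod>y\<in>#z. s y"

lemma mprod_bounds:
  assumes "\<forall>y. s y \<in> {0..1}"
  shows "0 \<le> mprod s z" "mprod s z \<le> 1"
  using assms by (induction z) (auto intro!: mult_le_one)

lemma mprod_mono:
  assumes "\<And>y. y \<in># z \<Longrightarrow> 0 \<le> u y \<and> u y \<le> v y"
  shows "0 \<le> mprod u z \<and> mprod u z \<le> mprod v z"
  using assms
proof (induction z)
  case (add a z)
  then have "0 \<le> mprod u z \<and> mprod u z \<le> mprod v z" "0 \<le> u a \<and> u a \<le> v a" by auto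
  then show ?case by (auto intro: mult_mono)
qed simp

lemma mprod_le_member:
  assumes "\<forall>y. s y \<in> {0..1}" "y \<in># z"
  shows "mprod s z \<le> s y"
proof -
  obtain z' where "z = add_mset y z'" using multi_member_split[OF assms(2)] by blast
  then show ?thesis using mprod_bounds[OF assms(1), of z'] assms(1) by (simp add: mult_left_le)
qed

lemma mprod_square: "mprod (\<lambda>y. (s y)\<^sup>2) z = (mprod s z)\<^sup>2"
  by (induction z) (auto simp: power_mult_distrib)

lemma progeny_gf_eq_expectation:
  fixes p :: "'x::countable offspring"
  assumes "\<forall>y. s y \<in> {0..1}"
  shows "progeny_gf p s x = measure_pmf.expectation (p x) (mprod s)"
proof -
  \<comment> \<open>Absolute summability, by domination with \<open>pmf (p x)\<close>, identifies
    the unordered sum \<open>infsum\<close> of the definition with the \<open>infsetsum\<close> that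
    expresses expectations.\<close>
  have "Infinite_Set_Sum.abs_summable_on (\<lambda>j. pmf (p x) j * mprod s j) UNIV"
  proof (rule Infinite_Set_Sum.abs_summable_on_comparison_test[OF pmf_abs_summable])
    show "norm (pmf (p x) j * mprod s j) \<le> norm (pmf (p x) j)" for j
      using mprod_bounds[OF assms, of j] by (simp add: mult_left_le abs_mult)
  qed
  then show ?thesis
    by (simp add: progeny_gf_def pmf_expectation_eq_infsetsum infsetsum_infsum
        image_prod_mset_multiplicity)
qed

lemma integrable_mprod_pmf:
  assumes "\<forall>y. s y \<in> {0..1}"
  shows "integrable (measure_pmf q) (mprod s)"
  by (rule measure_pmf.integrable_const_bound[of _ 1]) (use mprod_bounds[OF assms] in auto)

lemma progeny_gf_bounds:
  fixes p :: "'x::countable offspring"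
  assumes "\<forall>y. s y \<in> {0..1}"
  shows "\<forall>y. progeny_gf p s y \<in> {0..1}"
  unfolding progeny_gf_eq_expectation[OF assms]
  using mprod_bounds[OF assms]
  by (auto intro!: measure_pmf.integral_le_const integrable_mprod_pmf[OF assms])

lemma progeny_gf_mono:
  fixes p :: "'x::countable offspring"
  assumes "\<forall>y. u y \<in> {0..1}" "\<forall>y. v y \<in> {0..1}" "\<forall>y. u y \<le> v y"
  shows "progeny_gf p u x \<le> progeny_gf p v x"
  unfolding progeny_gf_eq_expectation[OF assms(1)] progeny_gf_eq_expectation[OF assms(2)]
  using assms mprod_mono[of _ u v] by (intro integral_mono integrable_mprod_pmf) auto

text \<open>Monotonicity of \<open>progeny_gf\<close> keeps the iterates above \<open>t\<close>:
  from \<open>G\<^sup>k t \<ge> t\<close> follows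
  \<open>G (G\<^sup>k t) \<ge> G t \<ge> t\<close>.\<close>

lemma progeny_gf_funpow:
  fixes p :: "'x::countable offspring"
  assumes "\<forall>y. t y \<in> {0..1}" "\<forall>y. t y \<le> progeny_gf p t y"
  shows "(\<forall>y. (progeny_gf p ^^ k) t y \<in> {0..1}) \<and> (\<forall>y. t y \<le> (progeny_gf p ^^ k) t y)"
proof (induction k)
  case (Suc k)
  then show ?case
    using progeny_gf_bounds[of "(progeny_gf p ^^ k) t" p]
      progeny_gf_mono[of t "(progeny_gf p ^^ k) t" p] assms
    by (auto intro: order_trans)
qed (use assms in simp)

text \<open>The right side minus the left side is the variance of \<open>mprod s\<close> under
  \<open>p x\<close>, because \<open>mprod\<close> commutes with squaring.\<close>

lemma square_progeny_gf_le:
  fixes p :: "'x::countable offspring"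
  assumes s: "\<forall>y. s y \<in> {0..1}"
  shows "(progeny_gf p s x)\<^sup>2 \<le> progeny_gf p (\<lambda>y. (s y)\<^sup>2) x"
proof -
  have t: "\<forall>y. (s y)\<^sup>2 \<in> {0..1}" using s by (auto intro: power_le_one)
  show ?thesis
    unfolding progeny_gf_eq_expectation[OF s] progeny_gf_eq_expectation[OF t] mprod_square
    using measure_pmf.variance_eq[of "p x" "mprod s"] integrable_mprod_pmf[OF s]
      integrable_mprod_pmf[OF t] measure_pmf.variance_positive[of "p x" "mprod s"]
    by (simp add: mprod_square)
qed

section \<open>The branching property\<close>

text \<open>The coordinate family is the identity map of a product space, so its joint law is the
  product of its marginals, which characterizes independence.\<close>

lemma litters_indep:
  "prob_space.indep_vars (litters p) (\<lambda>(n, y, i). measure_pmf (p y)) (\<lambda>k \<omega>. \<omega> k) UNIV"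
proof -
  interpret prob_space "litters p" by (rule prob_space_litters)
  let ?M = "\<lambda>(n :: nat, y, i :: nat). measure_pmf (p y)"
  have rv: "random_variable (?M k) (\<lambda>\<omega>. \<omega> k)" for k
    unfolding litters_def by (rule measurable_component_singleton) simp
  have "distr (litters p) (?M k) (\<lambda>\<omega>. \<omega> k) = ?M k" for k
    unfolding litters_def
    by (rule distr_PiM_component) (auto intro: measure_pmf.prob_space_axioms)
  then have "distr (litters p) (Pi\<^sub>M UNIV ?M) (\<lambda>\<omega>. \<lambda>k\<in>UNIV. \<omega> k)
      = Pi\<^sub>M UNIV (\<lambda>k. distr (litters p) (?M k) (\<lambda>\<omega>. \<omega> k))"
    by (simp add: litters_def restrict_def distr_id)
  then show ?thesis
    by (subst indep_vars_iff_distr_eq_PiM) (use rv in auto)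
qed

lemma nn_integral_litter:
  "(\<integral>\<^sup>+\<omega>. f (\<omega> (n, y, i)) \<partial>litters p) = (\<integral>\<^sup>+j. f j \<partial>measure_pmf (p y))"
proof -
  have "distr (litters p) (measure_pmf (p y)) (\<lambda>\<omega>. \<omega> (n, y, i)) = measure_pmf (p y)"
    using distr_PiM_component[of UNIV "\<lambda>(n, y, i). measure_pmf (p y)" "(n, y, i)"]
    by (auto simp: litters_def intro: measure_pmf.prob_space_axioms)
  moreover have "(\<lambda>\<omega>. \<omega> (n, y, i)) \<in> measurable (litters p) (measure_pmf (p y))"
    using measurable_litter[of n y i p] by simp
  ultimately show ?thesis
    using nn_integral_distr[of "\<lambda>\<omega>. \<omega> (n, y, i)" "litters p" "measure_pmf (p y)" f] by simp
qed

text \<open>Generation \<open>k\<close> is computed from litters of generations before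
  \<open>k\<close> only. This makes the event that generation \<open>m\<close> takes a given value
  independent of the litters of generation \<open>m\<close>.\<close>

lemma generation_cong:
  assumes "\<And>n y i. n < m \<Longrightarrow> \<omega> (n, y, i) = \<omega>' (n, y, i)" "k \<le> m"
  shows "generation x \<omega> k = generation x \<omega>' k"
  using assms(2)
proof (induction k)
  case (Suc k)
  then show ?case using assms(1) by (simp add: Let_def)
qed simp

text \<open>An event of the past and the litters in \<open>F\<close> depend on disjoint blocks of
  independent coordinates, so the integral of the product factorizes. Nonnegative integrals leave
  \<open>f\<close> arbitrary.\<close>

lemma nn_integral_past_times_litters:
  fixes p :: "'x::countable offspring"
  assumes [measurable]: "Measurable.pred (litters p) Q"
    and past: "\<And>\<omega> \<omega>'. (\<And>n y i. n < m \<Longrightarrow> \<omega> (n, y, i) = \<omega>' (n, y, i)) \<Longrightarrow> Q \<omega> = Q \<omega>'"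
    and F: "finite F"
  shows "(\<integral>\<^sup>+\<omega>. indicator {\<omega>. Q \<omega>} \<omega> * (\<Prod>(y, i)\<in>F. f y (\<omega> (m, y, i))) \<partial>litters p)
    = (\<integral>\<^sup>+\<omega>. indicator {\<omega>. Q \<omega>} \<omega> \<partial>litters p) * (\<Prod>(y, i)\<in>F. \<integral>\<^sup>+j. f y j \<partial>measure_pmf (p y))"
proof -
  interpret prob_space "litters p" by (rule prob_space_litters)
  define M' where "M' = (\<lambda>(n :: nat, y, i :: nat). measure_pmf (p y))"
  \<comment> \<open>The index \<open>None\<close> stands for the block of all coordinates before
    generation \<open>m\<close>; each \<open>Some (y, i)\<close> stands for one litter of generation
    \<open>m\<close>.\<close>
  define J where "J = insert None (Some ` F)"
  define K where "K = case_option {k. fst k < m} (\<lambda>(y :: 'x, i :: nat). {(m, y, i)})"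
  \<comment> \<open>A restricted function is undefined off its block. Filling the remaining
    coordinates with \<open>{#}\<close> produces a sample point at which \<open>Q\<close> has the
    same value, by \<open>past\<close>.\<close>
  define ext :: "(nat \<times> 'x \<times> nat \<Rightarrow> 'x multiset) \<Rightarrow> nat \<times> 'x \<times> nat \<Rightarrow> 'x multiset"
    where "ext v = (\<lambda>k. if fst k < m then v k else {#})" for v
  define Y :: "('x \<times> nat) option \<Rightarrow> (nat \<times> 'x \<times> nat \<Rightarrow> 'x multiset) \<Rightarrow> ennreal"
    where "Y = case_option (\<lambda>v. indicator {\<omega>. Q \<omega>} (ext v)) (\<lambda>(y, i) v. f y (v (m, y, i)))"
  have lit: "litters p = Pi\<^sub>M UNIV M'" by (simp add: litters_def M'_def)
  have ext: "ext \<in> measurable (Pi\<^sub>M {k. fst k < m} M') (litters p)"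
    unfolding lit ext_def
  proof (rule measurable_PiM_single')
    fix k
    have "(\<lambda>\<omega>. \<omega> k) \<in> measurable (Pi\<^sub>M {k. fst k < m} M') (M' k)" if "fst k < m"
      using that by (intro measurable_component_singleton) simp
    then show "(\<lambda>\<omega>. if fst k < m then \<omega> k else {#}) \<in> measurable (Pi\<^sub>M {k. fst k < m} M') (M' k)"
      by (cases "fst k < m") (auto simp: M'_def split: prod.splits)
  qed (auto simp: M'_def split: prod.splits)
  have "indep_vars M' (\<lambda>k \<omega>. \<omega> k) UNIV"
    using litters_indep[of p] by (simp add: M'_def)
  then have "indep_vars (\<lambda>j. Pi\<^sub>M (K j) M') (\<lambda>j \<omega>. restrict \<omega> (K j)) J"
    by (rule indep_vars_restrict)
       (auto simp: disjoint_family_on_def J_def K_def split: option.splits)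
  then have "indep_vars (\<lambda>_. borel) (\<lambda>j \<omega>. Y j (restrict \<omega> (K j))) J"
  proof (rule indep_vars_compose2)
    fix j assume "j \<in> J"
    show "Y j \<in> borel_measurable (Pi\<^sub>M (K j) M')"
    proof (cases j)
      case None
      have "(\<lambda>v. indicator {\<omega>. Q \<omega>} (ext v) :: ennreal) \<in> borel_measurable (Pi\<^sub>M {k. fst k < m} M')"
        by (rule measurable_compose[OF ext]) measurable
      then show ?thesis using None by (simp add: Y_def K_def)
    next
      case (Some k)
      then obtain y i where k: "j = Some (y, i)" by (cases k) auto
      have "(\<lambda>v. v (m, y, i)) \<in> measurable (Pi\<^sub>M {(m, y, i)} M') (M' (m, y, i))"
        by (rule measurable_component_singleton) simp
      then have "(\<lambda>v. f y (v (m, y, i))) \<in> borel_measurable (Pi\<^sub>M {(m, y, i)} M')"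
        by (rule measurable_compose) (simp add: M'_def)
      then show ?thesis using k by (simp add: Y_def K_def)
    qed
  qed
  then have "(\<integral>\<^sup>+\<omega>. (\<Prod>j\<in>J. Y j (restrict \<omega> (K j))) \<partial>litters p)
      = (\<Prod>j\<in>J. \<integral>\<^sup>+\<omega>. Y j (restrict \<omega> (K j)) \<partial>litters p)"
    by (intro indep_vars_nn_integral) (use F in \<open>auto simp: J_def\<close>)
  moreover have "Y None (restrict \<omega> (K None)) = indicator {\<omega>. Q \<omega>} \<omega>" for \<omega>
    using past[of "ext (restrict \<omega> (K None))" \<omega>]
    by (simp add: Y_def K_def ext_def indicator_def)
  moreover have "Y (Some k) (restrict \<omega> (K (Some k))) = (case k of (y, i) \<Rightarrow> f y (\<omega> (m, y, i)))" for \<omega> k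
    by (simp add: Y_def K_def split: prod.splits)
  moreover have "(\<integral>\<^sup>+\<omega>. f (fst k) (\<omega> (m, k)) \<partial>litters p) = (\<integral>\<^sup>+j. f (fst k) j \<partial>measure_pmf (p (fst k)))" for k
    using nn_integral_litter[where f = "f (fst k)" and n = m and y = "fst k" and i = "snd k"] by simp
  ultimately show ?thesis
    using F by (simp add: J_def prod.reindex case_prod_beta)
qed

lemma mprod_sum: "mprod s (\<Sum>i\<in>I. g i) = (\<Prod>i\<in>I. mprod s (g i))"
  by (induction I rule: infinite_finite_induct) auto

text \<open>Given the past, each type-\<open>y\<close> individual of generation \<open>m\<close>
  contributes an independent factor with mean \<open>progeny_gf p s y\<close>. In place of a
  conditional expectation, the identity is tested against events determined by the litters before
  generation \<open>m\<close>, the form that a stopping argument needs.\<close>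

lemma branching:
  fixes p :: "'x::countable offspring"
  assumes s: "\<forall>y. s y \<in> {0..1}"
    and [measurable]: "Measurable.pred (litters p) Q"
    and past: "\<And>\<omega> \<omega>'. (\<And>n y i. n < m \<Longrightarrow> \<omega> (n, y, i) = \<omega>' (n, y, i)) \<Longrightarrow> Q \<omega> = Q \<omega>'"
  shows "(\<integral>\<omega>. indicator {\<omega>. Q \<omega>} \<omega> * mprod s (generation x \<omega> (Suc m)) \<partial>litters p)
    = (\<integral>\<omega>. indicator {\<omega>. Q \<omega>} \<omega> * mprod (progeny_gf p s) (generation x \<omega> m) \<partial>litters p)"
proof -
  let ?Z = "\<lambda>n \<omega>. generation x \<omega> n"
  have s': "\<forall>y. progeny_gf p s y \<in> {0..1}" by (rule progeny_gf_bounds[OF s])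
  have meas: "(\<lambda>\<omega>. indicator {\<omega>. Q \<omega>} \<omega> * mprod u (?Z n \<omega>)) \<in> borel_measurable (litters p)" for u n
  proof -
    have "(\<lambda>\<omega>. mprod u (?Z n \<omega>)) \<in> borel_measurable (litters p)"
      by (rule measurable_compose[OF measurable_generation]) simp
    then show ?thesis by measurable
  qed
  \<comment> \<open>On the slice where generation \<open>m\<close> equals a fixed \<open>z\<close>,
    the random product over individuals becomes a product over the fixed finite set
    \<open>F\<close>.\<close>
  have slice: "(\<integral>\<^sup>+\<omega>. ennreal (indicator {\<omega>. Q \<omega>} \<omega> * mprod s (?Z (Suc m) \<omega>)) * indicator {?Z m \<omega>} z \<partial>litters p)
      = (\<integral>\<^sup>+\<omega>. ennreal (indicator {\<omega>. Q \<omega>} \<omega> * mprod (progeny_gf p s) (?Z m \<omega>)) * indicator {?Z m \<omega>} z \<partial>litters p)" for z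
  proof -
    define F where "F = (SIGMA y:set_mset z. {..<count z y})"
    let ?R = "\<lambda>\<omega>. Q \<omega> \<and> ?Z m \<omega> = z"
    have gf: "(\<integral>\<^sup>+j. ennreal (mprod s j) \<partial>measure_pmf (p y)) = ennreal (progeny_gf p s y)" for y
      unfolding progeny_gf_eq_expectation[OF s]
      by (rule nn_integral_eq_integral[OF integrable_mprod_pmf[OF s]]) (use mprod_bounds[OF s] in auto)
    have F: "finite F" by (simp add: F_def)
    have [measurable]: "Measurable.pred (litters p) (\<lambda>\<omega>. ?Z m \<omega> = z)"
      by (rule measurable_compose[OF measurable_generation]) simp
    have R: "Measurable.pred (litters p) ?R" by measurable
    have "ennreal (indicator {\<omega>. Q \<omega>} \<omega> * mprod s (?Z (Suc m) \<omega>)) * indicator {?Z m \<omega>} z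
        = indicator {\<omega>. ?R \<omega>} \<omega> * (\<Prod>(y, i)\<in>F. ennreal (mprod s (\<omega> (m, y, i))))" for \<omega>
    proof (cases "?R \<omega>")
      case True
      then have "mprod s (?Z (Suc m) \<omega>) = (\<Prod>(y, i)\<in>F. mprod s (\<omega> (m, y, i)))"
        by (simp add: mprod_sum F_def prod.Sigma)
      then show ?thesis
        using True mprod_bounds[OF s] by (simp add: case_prod_beta prod_ennreal)
    qed (auto simp: indicator_def)
    then have "(\<integral>\<^sup>+\<omega>. ennreal (indicator {\<omega>. Q \<omega>} \<omega> * mprod s (?Z (Suc m) \<omega>)) * indicator {?Z m \<omega>} z \<partial>litters p)
        = (\<integral>\<^sup>+\<omega>. indicator {\<omega>. ?R \<omega>} \<omega> * (\<Prod>(y, i)\<in>F. ennreal (mprod s (\<omega> (m, y, i)))) \<partial>litters p)"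
      by simp
    also have "\<dots> = (\<integral>\<^sup>+\<omega>. indicator {\<omega>. ?R \<omega>} \<omega> \<partial>litters p)
        * (\<Prod>(y, i)\<in>F. \<integral>\<^sup>+j. ennreal (mprod s j) \<partial>measure_pmf (p y))"
    proof (rule nn_integral_past_times_litters[OF R _ F])
      fix \<omega> \<omega>' :: "nat \<times> 'x \<times> nat \<Rightarrow> 'x multiset"
      assume *: "\<And>n y i. n < m \<Longrightarrow> \<omega> (n, y, i) = \<omega>' (n, y, i)"
      show "?R \<omega> = ?R \<omega>'"
        using past[of \<omega> \<omega>'] generation_cong[of m \<omega> \<omega>' m x] * by auto
    qed
    also have "(\<Prod>(y, i)\<in>F. \<integral>\<^sup>+j. ennreal (mprod s j) \<partial>measure_pmf (p y)) = ennreal (mprod (progeny_gf p s) z)"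
    proof -
      have "(\<Prod>(y, i)\<in>F. ennreal (progeny_gf p s y)) = (\<Prod>y\<in>set_mset z. \<Prod>i<count z y. ennreal (progeny_gf p s y))"
        unfolding F_def by (rule prod.Sigma[symmetric]) auto
      also have "\<dots> = ennreal (mprod (progeny_gf p s) z)"
        using s' by (simp add: image_prod_mset_multiplicity prod_ennreal ennreal_power)
      finally show ?thesis by (simp add: gf)
    qed
    also have "(\<integral>\<^sup>+\<omega>. indicator {\<omega>. ?R \<omega>} \<omega> \<partial>litters p) * \<dots>
        = (\<integral>\<^sup>+\<omega>. indicator {\<omega>. ?R \<omega>} \<omega> * ennreal (mprod (progeny_gf p s) z) \<partial>litters p)"
      using R by (subst nn_integral_multc) auto
    also have "\<dots> = (\<integral>\<^sup>+\<omega>. ennreal (indicator {\<omega>. Q \<omega>} \<omega> * mprod (progeny_gf p s) (?Z m \<omega>)) * indicator {?Z m \<omega>} z \<partial>litters p)"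
      by (rule nn_integral_cong) (auto simp: indicator_def)
    finally show ?thesis .
  qed
  \<comment> \<open>Only countably many multisets exist, so the slices are put together again by
    exchanging the sum over \<open>z\<close> with the integral.\<close>
  have split: "(\<integral>\<^sup>+\<omega>. ennreal (g \<omega>) \<partial>litters p)
      = (\<integral>\<^sup>+z. \<integral>\<^sup>+\<omega>. ennreal (g \<omega>) * indicator {?Z m \<omega>} z \<partial>litters p \<partial>count_space UNIV)"
    if [measurable]: "g \<in> borel_measurable (litters p)" for g
  proof -
    have "(\<integral>\<^sup>+z. \<integral>\<^sup>+\<omega>. ennreal (g \<omega>) * indicator {?Z m \<omega>} z \<partial>litters p \<partial>count_space UNIV)
        = (\<integral>\<^sup>+\<omega>. \<integral>\<^sup>+z. ennreal (g \<omega>) * indicator {?Z m \<omega>} z \<partial>count_space UNIV \<partial>litters p)"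
    proof (rule nn_integral_count_space_nn_integral[OF countable_multisets, symmetric])
      fix z :: "'x multiset"
      have "(\<lambda>\<omega>. indicator {?Z m \<omega>} z :: ennreal) \<in> borel_measurable (litters p)"
        by (rule measurable_compose[OF measurable_generation]) simp
      then show "(\<lambda>\<omega>. ennreal (g \<omega>) * indicator {?Z m \<omega>} z) \<in> borel_measurable (litters p)"
        by measurable
    qed
    also have "\<dots> = (\<integral>\<^sup>+\<omega>. ennreal (g \<omega>) \<partial>litters p)"
      by (intro nn_integral_cong) simp
    finally show ?thesis ..
  qed
  have "(\<integral>\<omega>. indicator {\<omega>. Q \<omega>} \<omega> * mprod u (?Z n \<omega>) \<partial>litters p)
      = enn2real (\<integral>\<^sup>+z. \<integral>\<^sup>+\<omega>. ennreal (indicator {\<omega>. Q \<omega>} \<omega> * mprod u (?Z n \<omega>)) * indicator {?Z m \<omega>} z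
          \<partial>litters p \<partial>count_space UNIV)" if "\<forall>y. u y \<in> {0..1}" for u n
    unfolding split[OF meas, symmetric]
    by (rule integral_eq_nn_integral[OF meas]) (use mprod_bounds[OF that] in auto)
  from this[OF s, of "Suc m"] this[OF s', of m] show ?thesis
    by (simp only: slice)
qed

section \<open>Expectations of generation products\<close>

lemma borel_measurable_generation:
  fixes p :: "'x::countable offspring"
  shows "(\<lambda>\<omega>. f (generation x \<omega> n) :: real) \<in> borel_measurable (litters p)"
  by (rule measurable_compose[OF measurable_generation]) simp

lemma pred_generation:
  fixes p :: "'x::countable offspring"
  shows "Measurable.pred (litters p) (\<lambda>\<omega>. R (generation x \<omega> n))"
  by (rule measurable_compose[OF measurable_generation]) simp

lemma integrable_indicator_mprod:
  fixes p :: "'x::countable offspring"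
  assumes s: "\<forall>y. s y \<in> {0..1}" and [measurable]: "Measurable.pred (litters p) Q"
  shows "integrable (litters p) (\<lambda>\<omega>. indicator {\<omega>. Q \<omega>} \<omega> * mprod s (generation x \<omega> n))"
proof -
  interpret prob_space "litters p" by (rule prob_space_litters)
  have [measurable]: "(\<lambda>\<omega>. mprod s (generation x \<omega> n)) \<in> borel_measurable (litters p)"
    by (rule borel_measurable_generation)
  show ?thesis
    by (rule integrable_const_bound[of _ 1]) (use mprod_bounds[OF s] in \<open>auto simp: indicator_def\<close>)
qed

lemma integrable_mprod:
  fixes p :: "'x::countable offspring"
  assumes "\<forall>y. s y \<in> {0..1}"
  shows "integrable (litters p) (\<lambda>\<omega>. mprod s (generation x \<omega> n))"
  using integrable_indicator_mprod[OF assms, where Q = "\<lambda>_. True"] by simp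

text \<open>Iterates \<open>branching\<close> with the sure event. Each step removes the last
  generation and replaces \<open>s\<close> by \<open>progeny_gf p s\<close>, so the induction runs
  over arbitrary \<open>s\<close>.\<close>

lemma expectation_mprod_add:
  fixes p :: "'x::countable offspring"
  assumes "\<forall>y. s y \<in> {0..1}"
  shows "(\<integral>\<omega>. mprod s (generation x \<omega> (n + k)) \<partial>litters p)
    = (\<integral>\<omega>. mprod ((progeny_gf p ^^ k) s) (generation x \<omega> n) \<partial>litters p)"
  using assms
proof (induction k arbitrary: s)
  case (Suc k)
  have "(\<integral>\<omega>. mprod s (generation x \<omega> (Suc (n + k))) \<partial>litters p)
      = (\<integral>\<omega>. mprod (progeny_gf p s) (generation x \<omega> (n + k)) \<partial>litters p)"
    using branching[OF Suc.prems, where Q = "\<lambda>_. True" and m = "n + k" and p = p and x = x] by simp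
  then show ?case
    using Suc.IH[OF progeny_gf_bounds[OF Suc.prems]] by (simp add: funpow_swap1 del: generation.simps)
qed simp

section \<open>Visits and extinction\<close>

text \<open>The iterate at \<open>y\<close> is the expectation of the squared product in generation
  \<open>k\<close> for the process started at \<open>y\<close>. For \<open>s\<close> in the unit
  cube with \<open>s \<le> G(s)\<close> it is never below \<open>(s y)\<^sup>2\<close>, so the
  inequality amounts to constancy in \<open>k\<close>. All \<open>k\<close> enter because a strict
  increase may show only after several generations.\<close>

definition stagnant :: "'x::countable offspring \<Rightarrow> ('x \<Rightarrow> real) \<Rightarrow> 'x \<Rightarrow> bool" where
  "stagnant p s y \<longleftrightarrow> (\<forall>k. (progeny_gf p ^^ k) (\<lambda>y. (s y)\<^sup>2) y \<le> (s y)\<^sup>2)"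

lemma square_bounds: "\<forall>y. s y \<in> {0..1} \<Longrightarrow> \<forall>y. (s y :: real)\<^sup>2 \<in> {0..1}"
  by (auto intro: power_le_one)

lemma square_subinvariant:
  fixes p :: "'x::countable offspring"
  assumes "\<forall>y. s y \<in> {0..1}" "\<forall>y. s y \<le> progeny_gf p s y"
  shows "\<forall>y. (s y)\<^sup>2 \<le> progeny_gf p (\<lambda>y. (s y)\<^sup>2) y"
  using assms square_progeny_gf_le[OF assms(1), of p]
  by (meson atLeastAtMost_iff order_trans power_mono)

text \<open>The difference equals the sum of the \<open>k\<close> terms from index \<open>m\<close>
  on minus the sum of the first \<open>k\<close> terms, whatever \<open>m\<close> is.\<close>

lemma sum_shift_le:
  fixes e :: "nat \<Rightarrow> real"
  assumes "\<And>n. 0 \<le> e n" "\<And>n. e n \<le> 1"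
  shows "(\<Sum>n<m. e (n + k)) - (\<Sum>n<m. e n) \<le> real k"
proof -
  have add: "(\<Sum>n<i + j. e n) = (\<Sum>n<i. e n) + (\<Sum>n<j. e (n + i))" for i j
    by (induction j) (auto simp: add.commute)
  have "(\<Sum>n<m. e (n + k)) + (\<Sum>n<k. e n) = (\<Sum>n<m. e n) + (\<Sum>n<k. e (n + m))"
    using add[of m k] add[of k m] by (simp add: add.commute)
  moreover have "(\<Sum>n<k. e (n + m)) \<le> real k"
    using sum_bounded_above[of "{..<k}" "\<lambda>n. e (n + m)" 1] assms by simp
  moreover have "0 \<le> (\<Sum>n<k. e n)" by (simp add: assms sum_nonneg)
  ultimately show ?thesis by linarith
qed

text \<open>If \<open>s y = 0\<close>, every term vanishes. Otherwise the \<open>n\<close>-th term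
  is at most a constant times the growth of the expected squared product from generation
  \<open>n\<close> to \<open>n + k\<close>, and these increments have partial sums at most
  \<open>k\<close>.\<close>

lemma summable_visits:
  fixes p :: "'x::countable offspring"
  assumes s: "\<forall>y. s y \<in> {0..1}" and sub: "\<forall>y. s y \<le> progeny_gf p s y"
    and y: "s y = 0 \<or> \<not> stagnant p s y"
  shows "summable (\<lambda>n. \<integral>\<omega>. indicator {\<omega>. y \<in># generation x \<omega> n} \<omega> * mprod (\<lambda>y. (s y)\<^sup>2) (generation x \<omega> n) \<partial>litters p)"
    (is "summable ?r")
proof (cases "s y = 0")
  case True
  have "indicator {\<omega>. y \<in># generation x \<omega> n} \<omega> * mprod (\<lambda>y. (s y)\<^sup>2) (generation x \<omega> n) = 0" for \<omega> n
    using mprod_le_member[OF square_bounds[OF s], of y "generation x \<omega> n"]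
      mprod_bounds[OF square_bounds[OF s], of "generation x \<omega> n"] True
    by (auto simp: indicator_def)
  then show ?thesis by (simp only: Bochner_Integration.integral_zero summable_zero)
next
  case False
  let ?Z = "\<lambda>n \<omega>. generation x \<omega> n"
  define t where "t = (\<lambda>y. (s y)\<^sup>2)"
  have t: "\<forall>y. t y \<in> {0..1}" "\<forall>y. t y \<le> progeny_gf p t y"
    unfolding t_def using square_bounds[OF s] square_subinvariant[OF s sub] by blast+
  obtain k where k: "t y < (progeny_gf p ^^ k) t y"
    using y False by (auto simp: stagnant_def t_def not_le)
  define u where "u = (progeny_gf p ^^ k) t"
  have u: "\<forall>y. u y \<in> {0..1}" "\<forall>y. t y \<le> u y"
    using progeny_gf_funpow[OF t] by (auto simp: u_def)
  have ty: "0 < t y" using False t by (simp add: t_def)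
  \<comment> \<open>The relative gain at one individual of type \<open>y\<close> from replacing
    \<open>t\<close> by \<open>u\<close>; at the other individuals the replacement does no harm
    because \<open>t \<le> u\<close>.\<close>
  define d where "d = u y / t y - 1"
  have d: "0 < d" using k ty by (simp add: d_def u_def)
  have gain: "d * mprod t z \<le> mprod u z - mprod t z" if "y \<in># z" for z
  proof -
    obtain z' where z: "z = add_mset y z'" using multi_member_split[OF \<open>y \<in># z\<close>] by blast
    have "u y * mprod t z' \<le> u y * mprod u z'"
      using mprod_mono[of z' t u] t u by (intro mult_left_mono) auto
    then show ?thesis using ty by (simp add: z d_def field_simps)
  qed
  define e where "e n = (\<integral>\<omega>. mprod t (?Z n \<omega>) \<partial>litters p)" for n
  interpret prob_space "litters p" by (rule prob_space_litters)
  have e: "0 \<le> e n" "e n \<le> 1" for n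
    unfolding e_def using mprod_bounds[OF t(1)]
    by (auto intro!: integral_le_const integrable_mprod[OF t(1)])
  have r: "0 \<le> ?r n" for n
    by (intro Bochner_Integration.integral_nonneg mult_nonneg_nonneg mprod_bounds square_bounds[OF s]) simp
  have step: "d * ?r n \<le> e (n + k) - e n" for n
  proof -
    have "d * ?r n = (\<integral>\<omega>. d * (indicator {\<omega>. y \<in># ?Z n \<omega>} \<omega> * mprod t (?Z n \<omega>)) \<partial>litters p)"
      by (simp add: t_def)
    also have "\<dots> \<le> (\<integral>\<omega>. mprod u (?Z n \<omega>) - mprod t (?Z n \<omega>) \<partial>litters p)"
    proof (rule integral_mono)
      show "integrable (litters p) (\<lambda>\<omega>. d * (indicator {\<omega>. y \<in># ?Z n \<omega>} \<omega> * mprod t (?Z n \<omega>)))"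
        by (intro integrable_mult_right integrable_indicator_mprod[OF t(1)] pred_generation)
      show "d * (indicator {\<omega>. y \<in># ?Z n \<omega>} \<omega> * mprod t (?Z n \<omega>)) \<le> mprod u (?Z n \<omega>) - mprod t (?Z n \<omega>)" for \<omega>
        using gain[of "?Z n \<omega>"] mprod_mono[of "?Z n \<omega>" t u] t u by (auto simp: indicator_def)
    qed (intro Bochner_Integration.integrable_diff integrable_mprod t u)
    also have "\<dots> = e (n + k) - e n"
      unfolding e_def u_def expectation_mprod_add[OF t(1)]
      using integrable_mprod[OF u(1)] integrable_mprod[OF t(1)] by (simp add: u_def)
    finally show ?thesis .
  qed
  show ?thesis
  proof (rule bounded_imp_summable[OF r])
    fix m
    have "d * (\<Sum>n\<le>m. ?r n) \<le> (\<Sum>n<Suc m. e (n + k) - e n)"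
      unfolding sum_distrib_left lessThan_Suc_atMost by (intro sum_mono step)
    also have "\<dots> \<le> real k"
      using sum_shift_le[where e = e and m = "Suc m" and k = k] e unfolding sum_subtractf by blast
    finally show "(\<Sum>n\<le>m. ?r n) \<le> real k / d"
      using d by (simp add: field_simps)
  qed
qed

section \<open>Extinction in a finite set of types\<close>

lemma ext_prob_eq:
  fixes p :: "'x::countable offspring"
  shows "ext_prob p A x
    = measure (litters p) {\<omega>. \<exists>N. \<forall>n\<ge>N. \<not> (\<exists>y\<in>A. y \<in># generation x \<omega> n)}"
proof -
  have "ext_prob p A x = measure (litters p) (generation x -` extinct_in A \<inter> space (litters p))"
    unfolding ext_prob_def gw_law_def
    by (rule measure_distr[OF measurable_generation_path])
       (use sets_extinct_in[of A p x] in \<open>simp add: gw_law_def\<close>)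
  also have "generation x -` extinct_in A \<inter> space (litters p)
      = {\<omega>. \<exists>N. \<forall>n\<ge>N. \<not> (\<exists>y\<in>A. y \<in># generation x \<omega> n)}"
    by (auto simp: extinct_in_eq eventually_sequentially litters_def space_PiM filter_mset_eq_mempty_iff split: prod.splits)
  finally show ?thesis .
qed

text \<open>Only the squares are summable over the visits; \<open>a \<le> \<epsilon> + a\<^sup>2 / \<epsilon>\<close> transfers this to the value of
  \<open>mprod s\<close> at the stopping time.\<close>

lemma le_ext_prob:
  fixes p :: "'x::countable offspring"
  assumes s: "\<forall>y. s y \<in> {0..1}" and sub: "\<forall>y. s y \<le> progeny_gf p s y"
    and A: "finite A" "\<And>y. y \<in> A \<Longrightarrow> s y = 0 \<or> \<not> stagnant p s y"
  shows "s x \<le> ext_prob p A x"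
proof -
  interpret prob_space "litters p" by (rule prob_space_litters)
  let ?Z = "\<lambda>n \<omega>. generation x \<omega> n"
  define t where "t = (\<lambda>y. (s y)\<^sup>2)"
  have t: "\<forall>y. t y \<in> {0..1}" unfolding t_def by (rule square_bounds[OF s])
  define hit where "hit z \<longleftrightarrow> (\<exists>y\<in>A. y \<in># z)" for z
  \<comment> \<open>No visit to \<open>A\<close> from generation \<open>N\<close> up to, but not
    including, generation \<open>m\<close>. The strict upper end makes \<open>B N (Suc m)\<close>
    depend on generations up to \<open>m\<close> only, as \<open>branching\<close> requires.\<close>
  define B where "B N m = {\<omega>. \<forall>n\<in>{N..<m}. \<not> hit (?Z n \<omega>)}" for N m
  define r where "r n = (\<Sum>y\<in>A. \<integral>\<omega>. indicator {\<omega>. y \<in># ?Z n \<omega>} \<omega> * mprod t (?Z n \<omega>) \<partial>litters p)" for n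
  have r: "summable r" "\<And>n. 0 \<le> r n"
    unfolding r_def t_def using summable_visits[OF s sub] A mprod_bounds[OF square_bounds[OF s]]
    by (auto intro!: summable_sum sum_nonneg)
  have space: "space (litters p) = UNIV" by (auto simp: litters_def space_PiM split: prod.splits)
  have [measurable]: "Measurable.pred (litters p) (\<lambda>\<omega>. hit (?Z n \<omega>))" for n by (rule pred_generation)
  have predB: "Measurable.pred (litters p) (\<lambda>\<omega>. \<forall>n\<in>{N..<m}. \<not> hit (?Z n \<omega>))" for N m by measurable
  then have B: "B N m \<in> sets (litters p)" for N m
    using predE[OF predB[of N m]] by (simp add: B_def space)
  have intB: "integrable (litters p) (\<lambda>\<omega>. indicator (B N m) \<omega> * mprod s (?Z n \<omega>))" for N m n
    unfolding B_def by (rule integrable_indicator_mprod[OF s predB])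
  have stopped: "s x \<le> prob (B N m) + \<epsilon> + (\<Sum>n=N..<m. r n) / \<epsilon>" if "N \<le> m" and \<epsilon>: "0 < \<epsilon>" for N m \<epsilon>
  proof -
    define a where "a m = (\<integral>\<omega>. indicator (B N m) \<omega> * mprod s (?Z m \<omega>) \<partial>litters p)" for m
    \<comment> \<open>Passing from \<open>m\<close> to \<open>Suc m\<close> first discards the paths
      whose first visit since \<open>N\<close> happens at time \<open>m\<close>, then lets the
      remaining paths branch, which cannot lower the expectation. The two error terms pay for the
      discarded paths.\<close>
    have descent: "a m \<le> a (Suc m) + \<epsilon> * (prob (B N m) - prob (B N (Suc m))) + r m / \<epsilon>" if "N \<le> m" for m
    proof -
      have [simp]: "integrable (litters p) (\<lambda>\<omega>. indicator {\<omega>. y \<in># ?Z m \<omega>} \<omega> * mprod t (?Z m \<omega>))" for y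
        by (intro integrable_indicator_mprod[OF t] pred_generation)
      have [simp]: "integrable (litters p) (indicat_real (B N m))" for m
        using B[of N m] by (simp add: integrable_indicator_iff emeasure_eq_measure)
      have "a m \<le> (\<integral>\<omega>. indicator (B N (Suc m)) \<omega> * mprod s (?Z m \<omega>)
          + \<epsilon> * (indicator (B N m) \<omega> - indicator (B N (Suc m)) \<omega>)
          + (\<Sum>y\<in>A. indicator {\<omega>. y \<in># ?Z m \<omega>} \<omega> * mprod t (?Z m \<omega>)) / \<epsilon> \<partial>litters p)"
        unfolding a_def
      proof (rule integral_mono)
        fix \<omega>
        have sum: "0 \<le> (\<Sum>y\<in>A. indicator {\<omega>. y \<in># ?Z m \<omega>} \<omega> * mprod t (?Z m \<omega>))"
          using mprod_bounds[OF t] by (intro sum_nonneg) auto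
        consider "hit (?Z m \<omega>)" "\<omega> \<in> B N m" | "\<not> hit (?Z m \<omega>) \<or> \<omega> \<notin> B N m" by blast
        then show "indicator (B N m) \<omega> * mprod s (?Z m \<omega>) \<le> indicator (B N (Suc m)) \<omega> * mprod s (?Z m \<omega>)
          + \<epsilon> * (indicator (B N m) \<omega> - indicator (B N (Suc m)) \<omega>)
          + (\<Sum>y\<in>A. indicator {\<omega>. y \<in># ?Z m \<omega>} \<omega> * mprod t (?Z m \<omega>)) / \<epsilon>"
        proof cases
          case 1
          then obtain y where y: "y \<in> A" "y \<in># ?Z m \<omega>" by (auto simp: hit_def)
          have "\<omega> \<notin> B N (Suc m)" using 1 that by (auto simp: B_def)
          have "(mprod s (?Z m \<omega>))\<^sup>2 = indicator {\<omega>. y \<in># ?Z m \<omega>} \<omega> * mprod t (?Z m \<omega>)"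
            using y by (simp add: t_def mprod_square)
          also have "\<dots> \<le> (\<Sum>y\<in>A. indicator {\<omega>. y \<in># ?Z m \<omega>} \<omega> * mprod t (?Z m \<omega>))"
            using A(1) y mprod_bounds[OF t]
            by (intro member_le_sum[where f = "\<lambda>y. indicator {\<omega>. y \<in># ?Z m \<omega>} \<omega> * mprod t (?Z m \<omega>)"]) auto
          finally have le: "(mprod s (?Z m \<omega>))\<^sup>2 / \<epsilon> \<le> (\<Sum>y\<in>A. indicator {\<omega>. y \<in># ?Z m \<omega>} \<omega> * mprod t (?Z m \<omega>)) / \<epsilon>"
            using \<epsilon> by (simp add: divide_right_mono)
          have "mprod s (?Z m \<omega>) \<le> \<epsilon> + (mprod s (?Z m \<omega>))\<^sup>2 / \<epsilon>"
          proof (cases "mprod s (?Z m \<omega>) \<le> \<epsilon>")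
            case False
            then have "\<epsilon> * mprod s (?Z m \<omega>) \<le> (mprod s (?Z m \<omega>))\<^sup>2"
              using \<epsilon> by (simp add: power2_eq_square)
            then have "mprod s (?Z m \<omega>) \<le> (mprod s (?Z m \<omega>))\<^sup>2 / \<epsilon>"
              using \<epsilon> by (simp add: field_simps)
            then show ?thesis using \<epsilon> by simp
          qed (use \<epsilon> in \<open>simp add: add_increasing2\<close>)
          then show ?thesis using le 1 \<open>\<omega> \<notin> B N (Suc m)\<close> by simp
        next
          case 2
          then have "(\<omega> \<in> B N (Suc m)) = (\<omega> \<in> B N m)" using that by (auto simp: B_def less_Suc_eq)
          then show ?thesis using sum \<epsilon> by (auto simp: indicator_def)
        qed
      qed (intro Bochner_Integration.integrable_add Bochner_Integration.integrable_diff
          integrable_mult_right integrable_divide Bochner_Integration.integrable_sum intB; simp)+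
      also have "\<dots> = (\<integral>\<omega>. indicator (B N (Suc m)) \<omega> * mprod s (?Z m \<omega>) \<partial>litters p)
          + \<epsilon> * (prob (B N m) - prob (B N (Suc m))) + r m / \<epsilon>"
        using B intB by (simp add: r_def Bochner_Integration.integral_sum)
      also have "(\<integral>\<omega>. indicator (B N (Suc m)) \<omega> * mprod s (?Z m \<omega>) \<partial>litters p) \<le> a (Suc m)"
      proof -
        have "a (Suc m) = (\<integral>\<omega>. indicator (B N (Suc m)) \<omega> * mprod (progeny_gf p s) (?Z m \<omega>) \<partial>litters p)"
          unfolding a_def B_def
        proof (rule branching[OF s predB])
          fix \<omega> \<omega>' :: "nat \<times> 'x \<times> nat \<Rightarrow> 'x multiset"
          assume "\<And>n y i. n < m \<Longrightarrow> \<omega> (n, y, i) = \<omega>' (n, y, i)"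
          then have "?Z n \<omega> = ?Z n \<omega>'" if "n \<le> m" for n
            using generation_cong[of m \<omega> \<omega>' n x] that by blast
          then show "(\<forall>n\<in>{N..<Suc m}. \<not> hit (?Z n \<omega>)) = (\<forall>n\<in>{N..<Suc m}. \<not> hit (?Z n \<omega>'))"
            by auto
        qed
        moreover have "(\<integral>\<omega>. indicator (B N (Suc m)) \<omega> * mprod s (?Z m \<omega>) \<partial>litters p) \<le> \<dots>"
        proof (rule integral_mono[OF intB])
          show "integrable (litters p) (\<lambda>\<omega>. indicator (B N (Suc m)) \<omega> * mprod (progeny_gf p s) (?Z m \<omega>))"
            unfolding B_def by (rule integrable_indicator_mprod[OF progeny_gf_bounds[OF s] predB])
          show "indicator (B N (Suc m)) \<omega> * mprod s (?Z m \<omega>)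
              \<le> indicator (B N (Suc m)) \<omega> * mprod (progeny_gf p s) (?Z m \<omega>)" for \<omega>
            using mprod_mono[of "?Z m \<omega>" s "progeny_gf p s"] s sub by (intro mult_left_mono) auto
        qed
        ultimately show ?thesis by simp
      qed
      finally show ?thesis by simp
    qed
    \<comment> \<open>\<open>B N N\<close> is the whole space, so \<open>a N\<close> is the plain
      expectation \<open>(progeny_gf p ^^ N) s x\<close>.\<close>
    have "s x \<le> a N"
    proof -
      have "a N = (progeny_gf p ^^ N) s x"
        using expectation_mprod_add[OF s, where x = x and n = 0 and k = N and p = p] by (simp add: a_def B_def prob_space)
      then show ?thesis using progeny_gf_funpow[OF s sub] by simp
    qed
    \<comment> \<open>When \<open>descent\<close> is summed, the probability differences telescope,
      so the factor \<open>\<epsilon>\<close> is charged only once in total.\<close>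
    also have "a N \<le> a m + \<epsilon> * (1 - prob (B N m)) + (\<Sum>n=N..<m. r n) / \<epsilon>"
      using \<open>N \<le> m\<close>
    proof (induction m rule: dec_induct)
      case base
      then show ?case using \<epsilon> by (simp add: prob_le_1)
    next
      case (step m)
      then show ?case using descent[of m] by (simp add: algebra_simps add_divide_distrib)
    qed
    also have "a m \<le> prob (B N m)"
    proof -
      have "a m \<le> (\<integral>\<omega>. indicator (B N m) \<omega> \<partial>litters p)"
        unfolding a_def
      proof (rule integral_mono[OF intB])
        show "integrable (litters p) (indicat_real (B N m))"
          using B[of N m] by (simp add: integrable_indicator_iff emeasure_eq_measure)
        show "indicator (B N m) \<omega> * mprod s (?Z m \<omega>) \<le> indicat_real (B N m) \<omega>" for \<omega>
          using mprod_bounds[OF s] by (simp add: indicator_def)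
      qed
      then show ?thesis using B[of N m] by simp
    qed
    also have "\<epsilon> * (1 - prob (B N m)) \<le> \<epsilon>" using \<epsilon> by (simp add: mult_left_le)
    finally show ?thesis by simp
  qed
  define R where "R N = suminf r - (\<Sum>n<N. r n)" for N
  have tail: "(\<Sum>n=N..<m. r n) \<le> R N" if "N \<le> m" for N m
  proof -
    have "(\<Sum>n<N. r n) + (\<Sum>n=N..<m. r n) = (\<Sum>n<m. r n)"
      using that by (metis atLeast0LessThan le0 sum.atLeastLessThan_concat)
    moreover have "(\<Sum>n<m. r n) \<le> suminf r" by (rule sum_le_suminf) (use r in auto)
    ultimately show ?thesis by (simp add: R_def)
  qed
  \<comment> \<open>The limits are taken in the order \<open>m\<close>, \<open>N\<close>,
    \<open>\<epsilon>\<close>: the horizon tends to infinity with \<open>N\<close> and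
    \<open>\<epsilon>\<close> fixed, then the tail \<open>R N\<close> vanishes, and finally
    \<open>\<epsilon>\<close> is arbitrary.\<close>
  have "s x \<le> ext_prob p A x + \<epsilon> + R N / \<epsilon>" if \<epsilon>: "0 < \<epsilon>" for N \<epsilon>
  proof -
    have "s x - \<epsilon> - R N / \<epsilon> \<le> prob (B N (m + N))" for m
    proof -
      have "(\<Sum>n=N..<m + N. r n) / \<epsilon> \<le> R N / \<epsilon>" using tail[of N "m + N"] \<epsilon> by (simp add: divide_right_mono)
      then show ?thesis using stopped[of N "m + N" \<epsilon>] \<epsilon> by simp
    qed
    moreover have "(\<lambda>m. prob (B N (m + N))) \<longlonglongrightarrow> prob (\<Inter>m. B N (m + N))"
      by (rule finite_Lim_measure_decseq) (use B in \<open>auto simp: decseq_def B_def\<close>)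
    ultimately have "s x - \<epsilon> - R N / \<epsilon> \<le> prob (\<Inter>m. B N (m + N))"
      by (intro LIMSEQ_le_const) auto
    also have "\<dots> \<le> ext_prob p A x"
      unfolding ext_prob_eq
    proof (rule finite_measure_mono)
      have "\<forall>n\<ge>N. \<not> hit (?Z n \<omega>)" if "\<forall>m. \<omega> \<in> B N (m + N)" for \<omega>
      proof (intro allI impI)
        fix n assume "N \<le> n"
        then show "\<not> hit (?Z n \<omega>)" using that[rule_format, of "Suc n"] by (auto simp: B_def)
      qed
      then show "(\<Inter>m. B N (m + N)) \<subseteq> {\<omega>. \<exists>N. \<forall>n\<ge>N. \<not> (\<exists>y\<in>A. y \<in># ?Z n \<omega>)}"
        by (auto simp: hit_def)
      have "{\<omega> \<in> space (litters p). \<exists>N. \<forall>n\<ge>N. \<not> hit (?Z n \<omega>)} \<in> sets (litters p)" by measurable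
      then show "{\<omega>. \<exists>N. \<forall>n\<ge>N. \<not> (\<exists>y\<in>A. y \<in># ?Z n \<omega>)} \<in> sets (litters p)"
        by (simp add: space hit_def)
    qed
    finally show ?thesis by simp
  qed
  moreover have "(\<lambda>N. ext_prob p A x + \<epsilon> + R N / \<epsilon>) \<longlonglongrightarrow> ext_prob p A x + \<epsilon> + 0 / \<epsilon>" if "0 < \<epsilon>" for \<epsilon>
  proof -
    have "R \<longlonglongrightarrow> suminf r - suminf r"
      unfolding R_def by (intro tendsto_intros summable_LIMSEQ r)
    then show ?thesis using that by (intro tendsto_intros) auto
  qed
  ultimately have "s x \<le> ext_prob p A x + \<epsilon>" if "0 < \<epsilon>" for \<epsilon>
    using LIMSEQ_le_const[of "\<lambda>N. ext_prob p A x + \<epsilon> + R N / \<epsilon>"] that by fastforce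
  then show ?thesis by (rule field_le_epsilon)
qed

section \<open>Stagnant types\<close>

lemma mean_offspring_pos_iff:
  fixes p :: "'x::countable offspring"
  shows "mean_offspring p u v > 0 \<longleftrightarrow> (\<exists>j\<in>set_pmf (p u). v \<in># j)"
proof -
  have "mean_offspring p u v = (\<integral>\<^sup>+j. of_nat (count j v) \<partial>distr (gw_law p u) (count_space UNIV) (\<lambda>Z. Z 1))"
    unfolding mean_offspring_def by (subst nn_integral_distr) simp_all
  also have "\<dots> = (\<integral>\<^sup>+j. of_nat (count j v) \<partial>measure_pmf (p u))"
    by (simp only: distr_first_generation)
  finally have "mean_offspring p u v = 0 \<longleftrightarrow> (\<forall>j\<in>set_pmf (p u). count j v = 0)"
    by (simp add: nn_integral_0_iff_AE AE_measure_pmf_iff)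
  then show ?thesis by (auto simp: zero_less_iff_neq_zero count_eq_zero_iff)
qed

lemma leads_to_refl: "leads_to p x x"
  by (simp add: leads_to_def)

lemma leads_to_trans: "leads_to p x y \<Longrightarrow> leads_to p y z \<Longrightarrow> leads_to p x z"
  unfolding leads_to_def by (rule rtrancl_trans)

lemma leads_to_offspring:
  fixes p :: "'x::countable offspring"
  shows "j \<in> set_pmf (p x) \<Longrightarrow> y \<in># j \<Longrightarrow> leads_to p x y"
  unfolding leads_to_def using mean_offspring_pos_iff[of p x y] by blast

lemma leads_to_induct [consumes 1, case_names refl step]:
  fixes p :: "'x::countable offspring"
  assumes "leads_to p x y" "P x"
    and "\<And>u j w. leads_to p x u \<Longrightarrow> j \<in> set_pmf (p u) \<Longrightarrow> w \<in># j \<Longrightarrow> P u \<Longrightarrow> P w"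
  shows "P y"
  using assms(1) unfolding leads_to_def
proof (induction rule: rtrancl_induct)
  case (step u w)
  then show ?case using assms(3)[of u _ w] mean_offspring_pos_iff[of p u w]
    unfolding leads_to_def by auto
qed (rule assms)

lemma progeny_gf_ge:
  fixes p :: "'x::countable offspring"
  assumes "\<forall>y. s y \<in> {0..1}" "\<And>j. j \<in> set_pmf (p x) \<Longrightarrow> a \<le> mprod s j"
  shows "a \<le> progeny_gf p s x"
  unfolding progeny_gf_eq_expectation[OF assms(1)]
  by (intro measure_pmf.integral_ge_const integrable_mprod_pmf[OF assms(1)])
     (simp add: AE_measure_pmf_iff assms)

text \<open>If \<open>s u = 1\<close>, the mean of \<open>mprod s\<close> over the litters of
  \<open>u\<close> is \<open>1\<close> although the integrand is at most \<open>1\<close>. So every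
  possible litter has product \<open>1\<close>, and each of its members has value
  \<open>1\<close>.\<close>

lemma eq_one_leads_to:
  fixes p :: "'x::countable offspring"
  assumes s: "\<forall>y. s y \<in> {0..1}" and sub: "\<forall>y. s y \<le> progeny_gf p s y"
    and "leads_to p y x" "s y = 1"
  shows "s x = 1"
  using assms(3)
proof (induction rule: leads_to_induct)
  case (step u j w)
  have "(\<integral>j. 1 - mprod s j \<partial>measure_pmf (p u)) = 1 - progeny_gf p s u"
    using integrable_mprod_pmf[OF s] by (simp add: progeny_gf_eq_expectation[OF s])
  also have "\<dots> = 0"
    using sub[rule_format, of u] step progeny_gf_bounds[OF s, of p] by (simp add: order_antisym)
  finally have "AE j in measure_pmf (p u). 1 - mprod s j = 0"
    using mprod_bounds[OF s] integrable_mprod_pmf[OF s]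
    by (subst (asm) integral_nonneg_eq_0_iff_AE) auto
  then have "mprod s j = 1" using step by (simp add: AE_measure_pmf_iff)
  then show ?case using mprod_le_member[OF s \<open>w \<in># j\<close>] s by (simp add: order_antisym)
qed (rule assms)

text \<open>By stagnation at \<open>k = 1\<close> the litter product has second moment at most
  \<open>(s x)\<^sup>2\<close>, while its mean is at least \<open>s x\<close>; hence it has no
  spread. The later iterates pass stagnation on to the children.\<close>

lemma stagnant_litter:
  fixes p :: "'x::countable offspring"
  assumes s: "\<forall>y. s y \<in> {0..1}" and sub: "\<forall>y. s y \<le> progeny_gf p s y"
    and x: "0 < s x" "stagnant p s x" and j: "j \<in> set_pmf (p x)"
  shows "mprod s j = s x" "\<And>w. w \<in># j \<Longrightarrow> stagnant p s w"
proof -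
  define t where "t = (\<lambda>y. (s y)\<^sup>2)"
  have t: "\<forall>y. t y \<in> {0..1}" "\<forall>y. t y \<le> progeny_gf p t y"
    unfolding t_def using square_bounds[OF s] square_subinvariant[OF s sub] by blast+
  have int: "integrable (measure_pmf (p x)) (mprod s)" "integrable (measure_pmf (p x)) (mprod t)"
    using integrable_mprod_pmf s t by blast+
  have stag: "(progeny_gf p ^^ k) t x \<le> t x" for k
    using x(2) by (simp add: stagnant_def t_def)
  have "(\<integral>j. (mprod s j - s x)\<^sup>2 \<partial>measure_pmf (p x))
      = (\<integral>j. mprod t j - 2 * s x * mprod s j + (s x)\<^sup>2 \<partial>measure_pmf (p x))"
    by (simp add: t_def mprod_square power2_diff algebra_simps)
  also have "\<dots> = progeny_gf p t x - 2 * s x * progeny_gf p s x + (s x)\<^sup>2"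
    using int by (simp add: progeny_gf_eq_expectation[OF s] progeny_gf_eq_expectation[OF t(1)])
  also have "\<dots> \<le> 2 * (s x * s x - s x * progeny_gf p s x)"
    using stag[of 1] by (simp add: t_def power2_eq_square)
  also have "\<dots> \<le> 0" using mult_left_mono[of "s x" "progeny_gf p s x" "s x"] sub x(1) by simp
  finally have le: "(\<integral>j. (mprod s j - s x)\<^sup>2 \<partial>measure_pmf (p x)) \<le> 0" .
  have "integrable (measure_pmf (p x)) (\<lambda>j. mprod t j - 2 * s x * mprod s j + (s x)\<^sup>2)"
    using int by simp
  then have "integrable (measure_pmf (p x)) (\<lambda>j. (mprod s j - s x)\<^sup>2)"
    by (simp add: t_def mprod_square power2_diff algebra_simps)
  then have "AE j in measure_pmf (p x). (mprod s j - s x)\<^sup>2 = 0"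
    using le Bochner_Integration.integral_nonneg[of "measure_pmf (p x)" "\<lambda>j. (mprod s j - s x)\<^sup>2"]
    by (subst integral_nonneg_eq_0_iff_AE[symmetric]) (auto intro: order_antisym)
  then have eq: "mprod s i = s x" if "i \<in> set_pmf (p x)" for i
    using that by (simp add: AE_measure_pmf_iff)
  then show "mprod s j = s x" using j .
  fix w assume w: "w \<in># j"
  obtain j' where j': "j = add_mset w j'" using multi_member_split[OF w] by blast
  show "stagnant p s w"
    unfolding stagnant_def
  proof
    fix k
    define u where "u = (progeny_gf p ^^ k) t"
    have u: "\<forall>y. u y \<in> {0..1}" "\<forall>y. t y \<le> u y" using progeny_gf_funpow[OF t] by (auto simp: u_def)
    have intu: "integrable (measure_pmf (p x)) (mprod u)" using integrable_mprod_pmf u by blast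
    have mono: "mprod t i \<le> mprod u i" for i using mprod_mono[of i t u] t u by auto
    \<comment> \<open>The chain \<open>t x \<le> G(t) x \<le> G(u) x \<le> t x\<close> closes up, so
      \<open>mprod t \<le> mprod u\<close> must be an equality on every possible litter.\<close>
    have "progeny_gf p t x \<ge> t x" using t by simp
    moreover have "progeny_gf p u x \<le> t x" using stag[of "Suc k"] by (simp add: u_def)
    moreover have "progeny_gf p t x \<le> progeny_gf p u x" using t u by (intro progeny_gf_mono) auto
    ultimately have "progeny_gf p t x = progeny_gf p u x" by linarith
    then have "(\<integral>i. mprod u i - mprod t i \<partial>measure_pmf (p x)) = 0"
      using int intu by (simp add: progeny_gf_eq_expectation[OF t(1)] progeny_gf_eq_expectation[OF u(1)])
    then have "AE i in measure_pmf (p x). mprod u i - mprod t i = 0"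
      using int intu mono by (subst (asm) integral_nonneg_eq_0_iff_AE) auto
    then have tu: "mprod t j = mprod u j" using j by (simp add: AE_measure_pmf_iff)
    \<comment> \<open>The product over \<open>j\<close> is \<open>(s x)\<^sup>2 > 0\<close>, so the
      siblings of \<open>w\<close> contribute a positive factor that can be cancelled to isolate
      \<open>w\<close>.\<close>
    have "mprod t j > 0" using eq[OF j] x(1) by (simp add: t_def mprod_square)
    then have "mprod t j' > 0" using t by (auto simp: j' zero_less_mult_iff not_less[symmetric])
    moreover have "u w * mprod t j' \<le> u w * mprod u j'" using mprod_mono[of j' t u] t u by (intro mult_left_mono) auto
    then have "u w * mprod t j' \<le> t w * mprod t j'" using tu by (simp add: j')
    ultimately have "u w \<le> t w" by (simp add: mult_le_cancel_right)
    then show "(progeny_gf p ^^ k) (\<lambda>y. (s y)\<^sup>2) w \<le> (s w)\<^sup>2" by (simp add: u_def t_def)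
  qed
qed

text \<open>A child \<open>w\<close> in a litter \<open>j\<close> of \<open>u\<close> satisfies
  \<open>s w \<ge> mprod s j = s u\<close>, so \<open>s\<close> does not decrease along edges. This
  also preserves the positivity that \<open>stagnant_litter\<close> asks for.\<close>

lemma stagnant_leads_to:
  fixes p :: "'x::countable offspring"
  assumes s: "\<forall>y. s y \<in> {0..1}" and sub: "\<forall>y. s y \<le> progeny_gf p s y"
    and x: "0 < s x" "stagnant p s x" and "leads_to p x y"
  shows "stagnant p s y \<and> s x \<le> s y"
  using assms(5)
proof (induction rule: leads_to_induct)
  case (step u j w)
  then have "0 < s u" "stagnant p s u" using x by auto
  note stagnant_litter[OF s sub this \<open>j \<in> set_pmf (p u)\<close>]
  then show ?case using mprod_le_member[OF s \<open>w \<in># j\<close>] step by auto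
qed (use x in simp)

lemma mprod_le_power:
  assumes "\<forall>y. s y \<in> {0..1}" "\<And>w. w \<in># z \<Longrightarrow> C w \<Longrightarrow> s w = c" "0 \<le> c"
  shows "mprod s z \<le> c ^ size {#w \<in># z. C w#}"
  using assms(2)
proof (induction z)
  case (add a z)
  then have "mprod s z \<le> c ^ size {#w \<in># z. C w#}" by simp
  then show ?case
    using add.prems[of a] assms(1,3) mprod_bounds[OF assms(1), of z]
      mult_mono[of "s a" 1 "mprod s z" "c ^ size {#w \<in># z. C w#}"]
    by (auto intro: mult_left_mono)
qed simp

lemma mprod_if_power:
  assumes "\<And>w. w \<in># z \<Longrightarrow> v w = (if C w then c else 1)"
  shows "mprod v z = c ^ size {#w \<in># z. C w#}"
  using assms by (induction z) auto

text \<open>By \<open>stagnant_leads_to\<close> in both directions, \<open>s\<close> has a single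
  value \<open>c\<close> in \<open>(0, 1)\<close> on the class. A litter with product
  \<open>c\<close> cannot have two members in the class, since its product would be at most
  \<open>c\<^sup>2\<close>. At the class member given by non-singularity, some possible litter does
  not have exactly one such member, so it has none.\<close>

lemma stagnant_class:
  fixes p :: "'x::countable offspring"
  assumes "nonsingular p"
    and s: "\<forall>y. s y \<in> {0..1}" and sub: "\<forall>y. s y \<le> progeny_gf p s y"
    and x: "0 < s x" "s x < 1" "stagnant p s x"
  shows "\<And>y j. communicate p y x \<Longrightarrow> j \<in> set_pmf (p y) \<Longrightarrow>
      mprod s j = s x \<and> size {#w \<in># j. communicate p w x#} \<le> 1"
    and "\<exists>y j. communicate p y x \<and> j \<in> set_pmf (p y) \<and> {#w \<in># j. communicate p w x#} = {#}"
proof -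
  have const: "0 < s y \<and> stagnant p s y \<and> s y = s x" if "communicate p y x" for y
  proof -
    have 1: "stagnant p s y \<and> s x \<le> s y"
      using stagnant_leads_to[OF s sub x(1,3)] that by (simp add: communicate_def)
    then have "s y \<le> s x"
      using stagnant_leads_to[OF s sub, of y x] that x(1) by (simp add: communicate_def)
    then show ?thesis using 1 x(1) by simp
  qed
  show one: "mprod s j = s x \<and> size {#w \<in># j. communicate p w x#} \<le> 1"
    if y: "communicate p y x" and j: "j \<in> set_pmf (p y)" for y j
  proof -
    have eq: "mprod s j = s x" using stagnant_litter(1)[OF s sub _ _ j] const[OF y] by simp
    have "s x ^ 1 \<le> s x ^ size {#w \<in># j. communicate p w x#}"
      using mprod_le_power[OF s, of j "\<lambda>w. communicate p w x" "s x"] const eq x(1) by simp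
    then have "size {#w \<in># j. communicate p w x#} \<le> 1"
      using power_decreasing_iff[OF x(1,2)] by blast
    then show ?thesis using eq by simp
  qed
  obtain y where y: "communicate p y x"
    and ns: "measure (gw_law p y) {Z. size {#w \<in># Z 1. communicate p w y#} = 1} < 1"
    using assms(1) unfolding nonsingular_def by blast
  \<comment> \<open>Communication is an equivalence, so the class of \<open>y\<close> in the
    definition of non-singularity is that of \<open>x\<close>.\<close>
  have "communicate p w y \<longleftrightarrow> communicate p w x" for w
    using y leads_to_trans unfolding communicate_def by metis
  then have "measure (gw_law p y) {Z. size {#w \<in># Z 1. communicate p w y#} = 1}
      = measure (distr (gw_law p y) (count_space UNIV) (\<lambda>Z. Z 1)) {j. size {#w \<in># j. communicate p w x#} = 1}"
    by (subst measure_distr) (auto simp: vimage_def)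
  then have lt: "measure (measure_pmf (p y)) {j. size {#w \<in># j. communicate p w x#} = 1} < 1"
    using ns by (simp only: distr_first_generation)
  have "\<exists>j\<in>set_pmf (p y). size {#w \<in># j. communicate p w x#} \<noteq> 1"
  proof (rule ccontr)
    assume "\<not> ?thesis"
    then have "measure (measure_pmf (p y)) {j. size {#w \<in># j. communicate p w x#} = 1} = 1"
      by (subst measure_pmf.prob_eq_1) (auto simp: AE_measure_pmf_iff)
    then show False using lt by simp
  qed
  then obtain j where "j \<in> set_pmf (p y)" "size {#w \<in># j. communicate p w x#} \<noteq> 1" by blast
  then have "size {#w \<in># j. communicate p w x#} = 0" using one[OF y, of j] by linarith
  then show "\<exists>y j. communicate p y x \<and> j \<in> set_pmf (p y) \<and> {#w \<in># j. communicate p w x#} = {#}"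
    using y \<open>j \<in> set_pmf (p y)\<close> by auto
qed

section \<open>Bounds by extinction probabilities\<close>

lemma le_ext_prob_singleton:
  fixes p :: "'x::countable offspring"
  assumes ns: "nonsingular p"
    and s: "\<forall>y. s y \<in> {0..1}" and sub: "\<forall>y. s y \<le> progeny_gf p s y" and x1: "s x \<noteq> 1"
  shows "s x \<le> ext_prob p {x} x"
proof (cases "s x = 0 \<or> \<not> stagnant p s x")
  case True
  then show ?thesis using le_ext_prob[OF s sub, of "{x}" x] by auto
next
  case False
  define c where "c = s x"
  have c: "0 < c" "c < 1" using s[rule_format, of x] x1 False by (auto simp: c_def)
  have x: "0 < s x" "s x < 1" "stagnant p s x" using c False by (auto simp: c_def)
  \<comment> \<open>The value \<open>0\<close> is given to types that lead to \<open>x\<close> but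
    are not reached from it: there \<open>v \<le> G(v)\<close> is trivial, and the process started
    at \<open>x\<close> never meets them.\<close>
  define v where "v w = (if leads_to p w x then if leads_to p x w then c else 0 else 1)" for w
  have v: "\<forall>y. v y \<in> {0..1}" using c by (simp add: v_def)
  have vx: "v x = c" by (simp add: v_def leads_to_refl)
  \<comment> \<open>A possible litter of a type reached from \<open>x\<close> contains no type of
    value \<open>0\<close>, so its members in the class contribute a factor \<open>c\<close> each
    and the others contribute \<open>1\<close>.\<close>
  have litter: "mprod v j = c ^ size {#w \<in># j. communicate p w x#}"
    if "leads_to p x y" "j \<in> set_pmf (p y)" for y j
    using that leads_to_trans[of p x y] leads_to_offspring[of j p y]
    by (intro mprod_if_power) (auto simp: v_def communicate_def)
  have subv: "v y \<le> progeny_gf p v y" for y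
  proof (cases "leads_to p y x")
    case yx: True
    show ?thesis
    proof (cases "leads_to p x y")
      case True
      have "c \<le> progeny_gf p v y"
      proof (rule progeny_gf_ge[OF v])
        fix j assume j: "j \<in> set_pmf (p y)"
        then have "size {#w \<in># j. communicate p w x#} \<le> 1"
          using stagnant_class(1)[OF ns s sub x _ j] yx True by (simp add: communicate_def)
        then have "c ^ 1 \<le> c ^ size {#w \<in># j. communicate p w x#}"
          using power_decreasing_iff[OF c] by blast
        then show "c \<le> mprod v j" using litter[OF True j] by simp
      qed
      then show ?thesis using yx True by (simp add: v_def)
    next
      case False
      then have "v y = 0" using yx by (simp add: v_def)
      then show ?thesis using progeny_gf_bounds[OF v, of p] by simp
    qed
  next
    case False
    have "1 \<le> progeny_gf p v y"
    proof (rule progeny_gf_ge[OF v])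
      fix j assume j: "j \<in> set_pmf (p y)"
      have "v w = 1" if "w \<in># j" for w
        using False leads_to_trans[OF leads_to_offspring[of j p y w, OF j that], of x] by (auto simp: v_def)
      then have "mprod v j = 1" using mprod_if_power[of j v "\<lambda>_. False" 1] by simp
      then show "1 \<le> mprod v j" by simp
    qed
    then show ?thesis using False by (simp add: v_def)
  qed
  \<comment> \<open>For \<open>s\<close>, members outside the class can make up the product
    \<open>c\<close>. For \<open>v\<close> they count as \<open>1\<close>, so a litter without
    members in the class has product \<open>1\<close>, whereas stagnation would force
    \<open>c\<close>.\<close>
  have "\<not> stagnant p v x"
  proof
    assume st: "stagnant p v x"
    obtain y j where y: "communicate p y x" and j: "j \<in> set_pmf (p y)" "{#w \<in># j. communicate p w x#} = {#}"
      using stagnant_class(2)[OF ns s sub x] by blast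
    have xy: "leads_to p x y" using y by (simp add: communicate_def)
    have vy: "v y = c" using y by (simp add: v_def communicate_def)
    have "stagnant p v y" using stagnant_leads_to[OF v _ _ st xy] subv c vx by simp
    then have "mprod v j = c" using stagnant_litter(1)[of v p y j] v j(1) subv c vy by simp
    then show False using litter[OF xy j(1)] j(2) c by simp
  qed
  then have "v x \<le> ext_prob p {x} x" using subv by (intro le_ext_prob[OF v]) auto
  then show ?thesis using vx by (simp add: c_def)
qed

text \<open>Irreducibility makes the class the whole typeset. So \<open>s < 1\<close> everywhere, as
  a value \<open>1\<close> would spread to all types, and no type of positive value is stagnant;
  \<open>le_ext_prob\<close> then applies to every finite set.\<close>

lemma le_partial_ext_prob:
  fixes p :: "'x::countable offspring"
  assumes ns: "nonsingular p" and irr: "irreducible_process p"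
    and s: "\<forall>y. s y \<in> {0..1}" and sub: "\<forall>y. s y \<le> progeny_gf p s y" and "s \<noteq> (\<lambda>_. 1)"
  shows "s x \<le> partial_ext_prob p x"
proof -
  have all: "communicate p u w" for u w using irr by (simp add: irreducible_process_def)
  obtain x0 where "s x0 \<noteq> 1" using assms(5) by auto
  then have "s y \<noteq> 1" for y
    using eq_one_leads_to[OF s sub, of y x0] all[of y x0] by (auto simp: communicate_def)
  then have lt: "s y < 1" for y using s[rule_format, of y] by (auto simp: less_le)
  \<comment> \<open>A litter without members in the class is empty here and has product
    \<open>1\<close> instead of \<open>s y < 1\<close>.\<close>
  have good: "s y = 0 \<or> \<not> stagnant p s y" for y
  proof (rule ccontr)
    assume "\<not> ?thesis"
    then have y: "0 < s y" "s y < 1" "stagnant p s y" using s[rule_format, of y] lt by (auto simp: less_le)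
    obtain w j where "j \<in> set_pmf (p w)" "{#w \<in># j. communicate p w y#} = {#}"
      using stagnant_class(2)[OF ns s sub y] by blast
    then have "mprod s j = s y" "j = {#}"
      using stagnant_class(1)[OF ns s sub y all, of j w] by (auto simp: all)
    then show False using y by simp
  qed
  interpret prob_space "gw_law p x" by (rule prob_space_gw_law)
  \<comment> \<open>The types with code at most \<open>n\<close> form increasing finite sets that
    eventually contain any given finite set, so the intersection over all finite sets becomes that
    of a decreasing sequence of events, and continuity from above applies.\<close>
  define A :: "nat \<Rightarrow> 'x set" where "A n = to_nat -` {..n}" for n
  have A: "finite (A n)" for n unfolding A_def by (rule finite_vimageI) auto
  have anti: "extinct_in C \<subseteq> extinct_in D" if "D \<subseteq> C" for C D :: "'x set"
    using that unfolding extinct_in_eq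
    by (auto elim!: eventually_mono simp: filter_mset_eq_mempty_iff)
  have "(\<Inter>n. extinct_in (A n)) = (\<Inter>A\<in>{A. finite A}. extinct_in A)"
  proof
    show "(\<Inter>n. extinct_in (A n)) \<subseteq> (\<Inter>A\<in>{A. finite A}. extinct_in A)"
    proof (rule INT_greatest)
      fix D :: "'x set" assume "D \<in> {A. finite A}"
      then have "finite (to_nat ` D)" by simp
      then obtain n where "\<forall>k\<in>to_nat ` D. k \<le> n" using finite_nat_set_iff_bounded_le by blast
      then have "D \<subseteq> A n" by (auto simp: A_def)
      then show "(\<Inter>n. extinct_in (A n)) \<subseteq> extinct_in D" using anti by blast
    qed
  qed (use A in auto)
  moreover have "(\<lambda>n. prob (extinct_in (A n))) \<longlonglongrightarrow> prob (\<Inter>n. extinct_in (A n))"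
    by (rule finite_Lim_measure_decseq) (auto simp: decseq_def A_def intro!: anti)
  moreover have "s x \<le> prob (extinct_in (A n))" for n
    using le_ext_prob[OF s sub A good] by (simp add: ext_prob_def)
  ultimately show ?thesis
    unfolding partial_ext_prob_def by (metis LIMSEQ_le_const)
qed

theorem theorem1:
  fixes p :: "'x::countable \<Rightarrow> 'x multiset pmf" and s :: "'x \<Rightarrow> real"
  assumes "nonsingular p"
    and "\<forall>x. s x \<in> {0..1}"
    and "\<forall>x. s x \<le> progeny_gf p s x"
  shows "(\<forall>x. s x = 1 \<or> s x \<le> ext_prob p {x} x)
    \<and> (\<forall>x. s x < 1 \<longrightarrow> (\<forall>y. leads_to p y x \<longrightarrow> s y \<le> ext_prob p {y} y))
    \<and> (irreducible_process p \<and> s \<noteq> (\<lambda>_. 1) \<longrightarrow> (\<forall>x. s x \<le> partial_ext_prob p x))"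
proof (intro conjI allI impI)
  fix x
  show i: "s x = 1 \<or> s x \<le> ext_prob p {x} x" for x
    using le_ext_prob_singleton[OF assms] by blast
  \<comment> \<open>A value \<open>1\<close> at \<open>y\<close> would be carried along the path to
    \<open>x\<close>, against \<open>s x < 1\<close>; this leaves the second alternative of
    \<open>i\<close>.\<close>
  show "s y \<le> ext_prob p {y} y" if "s x < 1" "leads_to p y x" for y
    using i[of y] eq_one_leads_to[OF assms(2,3) that(2)] that(1) by auto
  show "s x \<le> partial_ext_prob p x" if "irreducible_process p \<and> s \<noteq> (\<lambda>_. 1)"
    using le_partial_ext_prob[OF assms(1) _ assms(2,3)] that by blast
qed

end
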